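(* Let $n$ and $r$ be positive integers and let $C_n(r)$ denote the number of $r$-colored partitions $\Lambda$ of $[n]$ with $\mathrm{cr}(\Lambda)<2$ (i.e. with no two crossing arcs of the same color). Let $e_1,\dots,e_r$ be the unit coordinate vectors of $\mathbb{R}^r$. Then $C_n(r)$ equals the number of $(n-1)$-step walks in $\mathbb{N}^r$ (all points having nonnegative integer coordinates) from the origin to itself, where each step is chosen from the following $(r+1)^2$ distinct steps: $\pm e_i$ for $i\in[r]$ ($2r$ steps), $e_i-e_j$ for ordered pairs $i\neq j$ ($r^2-r$ steps), and $r+1$ distinct zero steps.
   Context: For a partition $P$ of $[n]=\{1,\dots,n\}$ (a set of disjoint nonempty blocks with union $[n]$), $\mathrm{Arc}(P)$ is the set of pairs $(i,j)$ with $i,j$ in the same block and $j$ the least element of that block greater than $i$. A sequence of arcs $(i_t,j_t)_{t\in[k]}$ is a $k$-crossing if $i_1<\dots<i_k<j_1<\dots<j_k$. An $r$-colored partition is $\Lambda=(P,\varphi)$ with $\varphi:\mathrm{Arc}(P)\to[r]$; $\mathrm{cr}(\Lambda)$ is the largest $k$ such that $P$ has a $k$-crossing whose arcs all have the same color under $\varphi$. *)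

theory Defs
  imports Main "HOL-Library.Disjoint_Sets" "HOL-Library.FuncSet" "HOL-Library.Function_Algebras"
begin

definition Arc :: "nat set set \<Rightarrow> (nat \<times> nat) set" where
  "Arc P = {(i, j). \<exists>B\<in>P. i \<in> B \<and> j \<in> B \<and> i < j \<and> (\<forall>l\<in>B. i < l \<longrightarrow> j \<le> l)}"

text \<open>A \<open>k\<close>-crossing \<open>(i\<^sub>1, j\<^sub>1), \<dots>, (i\<^sub>k, j\<^sub>k)\<close> is a list of \<open>k\<close> arcs; the chain
  \<open>i\<^sub>1 < \<dots> < i\<^sub>k < j\<^sub>1 < \<dots> < j\<^sub>k\<close> says that the left endpoints followed by the right endpoints
  are strictly increasing. The empty list is a 0-crossing.\<close>

definition is_crossing :: "nat set set \<Rightarrow> nat \<Rightarrow> (nat \<times> nat) list \<Rightarrow> bool" where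
  "is_crossing P k as \<longleftrightarrow>
     length as = k \<and> set as \<subseteq> Arc P \<and> sorted_wrt (<) (map fst as @ map snd as)"

text \<open>Colorings are extensional functions on the arcs, so that distinct functions are
  distinct colorings.\<close>

definition colored_partitions :: "nat \<Rightarrow> nat \<Rightarrow> (nat set set \<times> (nat \<times> nat \<Rightarrow> nat)) set" where
  "colored_partitions n r = {(P, \<phi>). partition_on {1..n} P \<and> \<phi> \<in> Arc P \<rightarrow>\<^sub>E {1..r}}"

definition cr :: "nat set set \<times> (nat \<times> nat \<Rightarrow> nat) \<Rightarrow> nat" where
  "cr \<Lambda> = (case \<Lambda> of (P, \<phi>) \<Rightarrow>
     Max {k. \<exists>as. is_crossing P k as \<and> (\<exists>c. \<forall>a\<in>set as. \<phi> a = c)})"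

definition Cnum :: "nat \<Rightarrow> nat \<Rightarrow> nat" where
  "Cnum n r = card {\<Lambda> \<in> colored_partitions n r. cr \<Lambda> < 2}"

text \<open>Vectors are integer-valued functions whose coordinates outside \<open>{1..r}\<close> vanish; addition
  and zero are pointwise. Steps are labels, separate from their displacement vectors, since
  \<open>r + 1\<close> of them share the displacement 0.\<close>

definition unit_vec :: "nat \<Rightarrow> nat \<Rightarrow> int" where
  "unit_vec i = (\<lambda>k. if k = i then 1 else 0)"

definition orthant :: "nat \<Rightarrow> (nat \<Rightarrow> int) set" where
  "orthant r = {v. (\<forall>k\<in>{1..r}. 0 \<le> v k) \<and> (\<forall>k. k \<notin> {1..r} \<longrightarrow> v k = 0)}"

datatype step = Up nat | Down nat | Exchange nat nat | Stay nat

primrec displacement :: "step \<Rightarrow> nat \<Rightarrow> int" where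
  "displacement (Up i) = unit_vec i"
| "displacement (Down i) = - unit_vec i"
| "displacement (Exchange i j) = unit_vec i - unit_vec j"
| "displacement (Stay c) = 0"

definition steps :: "nat \<Rightarrow> step set" where
  "steps r = Up ` {1..r} \<union> Down ` {1..r}
     \<union> {Exchange i j | i j. i \<in> {1..r} \<and> j \<in> {1..r} \<and> i \<noteq> j} \<union> Stay ` {1..r + 1}"

definition position :: "step list \<Rightarrow> nat \<Rightarrow> nat \<Rightarrow> int" where
  "position w t = sum_list (map displacement (take t w))"

definition closed_walks :: "nat \<Rightarrow> nat \<Rightarrow> step list set" where
  "closed_walks r m = {w. length w = m \<and> set w \<subseteq> steps r \<and>
     (\<forall>t\<le>m. position w t \<in> orthant r) \<and> position w m = 0}"

lemma card_steps: "card (steps r) = (r + 1)\<^sup>2"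
proof -
  let ?E = "{Exchange i j | i j. i \<in> {1..r} \<and> j \<in> {1..r} \<and> i \<noteq> j}"
  have E: "?E = case_prod Exchange ` ({1..r} \<times> {1..r} - (\<lambda>i. (i, i)) ` {1..r})"
    by auto
  have "card ?E = card ({1..r} \<times> {1..r} - (\<lambda>i. (i, i)) ` {1..r})"
    unfolding E by (rule card_image) (auto simp: inj_on_def)
  also have "\<dots> = r * r - r"
    by (subst card_Diff_subset) (auto simp: card_image inj_on_def card_cartesian_product)
  finally have cE: "card ?E = r * r - r" .
  have fE: "finite ?E" unfolding E by simp
  have "card (steps r) = card (Up ` {1..r}) + card (Down ` {1..r}) + card ?E + card (Stay ` {1..r + 1})"
    unfolding steps_def using fE
    by (subst card_Un_disjoint; (auto; fail)?)+
  also have "\<dots> = r + r + (r * r - r) + (r + 1)"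
    using cE by (simp add: card_image inj_on_def)
  also have "\<dots> = (r + 1)\<^sup>2"
    using le_square[of r] by (simp add: power2_eq_square)
  finally show ?thesis .
qed

end

theory Submission
  imports Defs
begin

text \<open>A colored partition is determined by its colored arcs. Without monochromatic crossings, an arc
  of color \<open>c\<close> ending at \<open>j\<close> has to start at the last point before \<open>j\<close> whose outgoing arc has
  color \<open>c\<close> and is not yet closed. So the arcs can be recovered from the colors (if any) of
  the arc opening and of the arc closing at every point, and all choices of such colors occur for
  which the number of open arcs of each color stays nonnegative and ends at 0. No arc closes at 1
  or opens at \<open>n\<close>; pairing the opening color at \<open>t\<close> with the closing color at \<open>t + 1\<close> turns
  the \<open>n\<close> points into \<open>n - 1\<close> steps, and the numbers of open arcs into the coordinates of the
  walk.\<close>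

text \<open>Choosing a partner for every element of \<open>A\<close> gives an injection, since no
  partner is shared. The relation will always be "joined by an arc of color \<open>c\<close>", which
  compares numbers of opening and closing points.\<close>

lemma card_le_if_related:
  assumes "finite B"
    and ex: "\<And>a. a \<in> A \<Longrightarrow> \<exists>b\<in>B. R a b"
    and uniq: "\<And>a a' b. R a b \<Longrightarrow> R a' b \<Longrightarrow> a = a'"
  shows "card A \<le> card B"
proof -
  obtain f where f: "\<And>a. a \<in> A \<Longrightarrow> f a \<in> B \<and> R a (f a)"
    using ex by metis
  have "inj_on f A"
    by (metis f inj_onI uniq)
  then show ?thesis
    using card_inj_on_le[of f A B] f assms(1) by blast
qed

section \<open>Partitions and arc sets\<close>

lemma Arc_less: "(i, j) \<in> Arc P \<Longrightarrow> i < j"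
  by (auto simp: Arc_def)

lemma Arc_rtrancl_block:
  assumes "partition_on S P" and "B \<in> P" and "(i, j) \<in> (Arc P)\<^sup>*"
  shows "i \<in> B \<longleftrightarrow> j \<in> B"
  using assms(3)
proof (induction rule: rtrancl_induct)
  case (step y z)
  obtain C where "C \<in> P" "y \<in> C" "z \<in> C"
    using step.hyps(2) by (auto simp: Arc_def)
  then have "y \<in> B \<longleftrightarrow> z \<in> B"
    using assms(1,2) by (metis IntI disjointD empty_iff partition_onD2)
  then show ?case using step.IH by simp
qed simp

text \<open>Induction on the distance \<open>j - i\<close>: the arc leaving \<open>i\<close> goes to
  the next element of \<open>B\<close>, which does not pass \<open>j\<close>.\<close>

lemma block_Arc_rtrancl:
  assumes "B \<in> P" and "i \<in> B" and "j \<in> B" and "i \<le> j"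
  shows "(i, j) \<in> (Arc P)\<^sup>*"
  using assms(2,4)
proof (induction "j - i" arbitrary: i rule: less_induct)
  case less
  show ?case
  proof (cases "i = j")
    case False
    define k where "k = (LEAST l. l \<in> B \<and> i < l)"
    have ij: "j \<in> B \<and> i < j" using False less.prems assms(3) by simp
    have k: "k \<in> B \<and> i < k"
      unfolding k_def by (rule LeastI, rule ij)
    have kmin: "k \<le> l" if "l \<in> B" "i < l" for l
      unfolding k_def using that by (simp add: Least_le)
    have "(i, k) \<in> Arc P"
      using k kmin less.prems assms(1) by (auto simp: Arc_def)
    moreover have "(k, j) \<in> (Arc P)\<^sup>*"
      using less.hyps[of k] k kmin[of j] ij by (simp add: diff_less_mono2)
    ultimately show ?thesis by (rule converse_rtrancl_into_rtrancl)
  qed simp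
qed

text \<open>Arcs never leave a block, and within it they lead from any element up to any larger one.
  This is what makes a partition recoverable from its arcs.\<close>

lemma block_eq_Arc_component:
  assumes "partition_on S P" and "B \<in> P" and "i \<in> B"
  shows "B = {j. (i, j) \<in> (Arc P)\<^sup>* \<or> (j, i) \<in> (Arc P)\<^sup>*}"
  using Arc_rtrancl_block[OF assms(1,2)] block_Arc_rtrancl[OF assms(2)] assms(3)
  by (auto; metis nat_le_linear)

lemma Arc_inj:
  assumes "partition_on S P" and "partition_on S Q" and "Arc P = Arc Q"
  shows "P = Q"
proof -
  have "P \<subseteq> Q" if P: "partition_on S P" and Q: "partition_on S Q" and eq: "Arc P = Arc Q" for P Q
  proof
    fix B assume B: "B \<in> P"
    then obtain i where i: "i \<in> B"
      using P by (metis all_not_in_conv partition_onD3)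
    then obtain C where C: "C \<in> Q" "i \<in> C"
      using B P Q by (metis UnionI UnionE partition_onD1)
    have "B = C"
      using block_eq_Arc_component[OF P B i] block_eq_Arc_component[OF Q C] eq by simp
    then show "B \<in> Q" using C by simp
  qed
  then show ?thesis using assms by (metis subset_antisym)
qed

lemma Arc_left_unique:
  assumes "partition_on S P" and "(i, j) \<in> Arc P" and "(i, k) \<in> Arc P"
  shows "j = k"
proof -
  obtain B C where B: "B \<in> P" "i \<in> B" "j \<in> B" "i < j" "\<forall>l\<in>B. i < l \<longrightarrow> j \<le> l"
    and C: "C \<in> P" "i \<in> C" "k \<in> C" "i < k" "\<forall>l\<in>C. i < l \<longrightarrow> k \<le> l"
    using assms(2,3) by (auto simp: Arc_def)
  have "B = C" using assms(1) B(1,2) C(1,2) by (metis IntI disjointD empty_iff partition_onD2)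
  then show ?thesis using B C by (meson le_antisym)
qed

lemma Arc_right_unique:
  assumes "partition_on S P" and "(i, j) \<in> Arc P" and "(k, j) \<in> Arc P"
  shows "i = k"
proof -
  obtain B C where B: "B \<in> P" "i \<in> B" "j \<in> B" "i < j" "\<forall>l\<in>B. i < l \<longrightarrow> j \<le> l"
    and C: "C \<in> P" "k \<in> C" "j \<in> C" "k < j" "\<forall>l\<in>C. k < l \<longrightarrow> j \<le> l"
    using assms(2,3) by (auto simp: Arc_def)
  have "B = C" using assms(1) B(1,3) C(1,3) by (metis IntI disjointD empty_iff partition_onD2)
  then show ?thesis using B C by (meson linorder_neqE_nat not_less)
qed

lemma Arc_subset:
  assumes "partition_on S P"
  shows "Arc P \<subseteq> S \<times> S"
  using partition_onD1[OF assms] by (auto simp: Arc_def)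

lemma rtrancl_less_imp_le:
  fixes A :: "(nat \<times> nat) set"
  assumes "\<And>i j. (i, j) \<in> A \<Longrightarrow> i < j" and "(i, j) \<in> A\<^sup>*"
  shows "i \<le> j"
  using assms(2) by induction (auto dest: assms(1))

text \<open>With at most one arc leaving and at most one entering each point, and all arcs going up,
  \<open>A\<close> is a disjoint union of increasing paths. Their vertex sets are the
  blocks.\<close>

lemma Arc_surj:
  fixes A :: "(nat \<times> nat) set"
  assumes sub: "A \<subseteq> S \<times> S"
    and less: "\<And>i j. (i, j) \<in> A \<Longrightarrow> i < j"
    and left: "single_valued A" and right: "single_valued (A\<inverse>)"
  obtains P where "partition_on S P" and "Arc P = A"
proof -
  define E where "E = {(i, j) \<in> S \<times> S. (i, j) \<in> A\<^sup>* \<or> (j, i) \<in> A\<^sup>*}"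
  have le: "i \<le> j" if "(i, j) \<in> A\<^sup>*" for i j
    using rtrancl_less_imp_le[OF less that] .
  \<comment> \<open>Paths neither branch nor merge: two points reached from the same point, or
    reaching the same point, lie on one path. This makes \<open>E\<close> transitive.\<close>
  have comp1: "(y, z) \<in> A\<^sup>* \<or> (z, y) \<in> A\<^sup>*" if "(x, y) \<in> A\<^sup>*" "(x, z) \<in> A\<^sup>*" for x y z
    using single_valued_confluent[OF left that] .
  have comp2: "(y, z) \<in> A\<^sup>* \<or> (z, y) \<in> A\<^sup>*" if "(y, x) \<in> A\<^sup>*" "(z, x) \<in> A\<^sup>*" for x y z
    using single_valued_confluent[OF right, of x y z] that by (simp add: rtrancl_converse) blast
  have E: "equiv S E"
  proof (rule equivI)
    show "E \<subseteq> S \<times> S" by (auto simp: E_def)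
    show "refl_on S E" by (auto simp: E_def refl_on_def)
    show "sym E" by (auto simp: E_def sym_def)
    show "trans E"
      by (rule transI) (auto simp: E_def intro: rtrancl_trans dest: comp1 comp2)
  qed
  define P where "P = S // E"
  have P: "partition_on S P" unfolding P_def by (rule partition_on_quotient[OF E])
  have arc: "(i, j) \<in> Arc P \<longleftrightarrow> (i, j) \<in> E \<and> i < j \<and> (\<forall>l. (i, l) \<in> E \<longrightarrow> i < l \<longrightarrow> j \<le> l)" for i j
  proof -
    have "B = E `` {i}" if "B \<in> P" "i \<in> B" for B
      using that E unfolding P_def by (metis Image_singleton_iff equiv_class_eq_iff quotientE)
    moreover have "E `` {i} \<in> P" "i \<in> E `` {i}" if "(i, j) \<in> E"
    proof -
      have i: "i \<in> S" using that by (simp add: E_def)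
      then show "E `` {i} \<in> P" unfolding P_def by (rule quotientI)
      show "i \<in> E `` {i}" using i by (rule equiv_class_self[OF E])
    qed
    ultimately show ?thesis unfolding Arc_def by blast
  qed
  have up: "(i, l) \<in> A\<^sup>*" if "(i, l) \<in> E" "i < l" for i l
    using that le[of l i] by (auto simp: E_def)
  have "(i, j) \<in> Arc P \<longleftrightarrow> (i, j) \<in> A" for i j
  proof
    assume "(i, j) \<in> Arc P"
    then have ij: "(i, j) \<in> E" "i < j" "\<And>l. (i, l) \<in> E \<Longrightarrow> i < l \<Longrightarrow> j \<le> l"
      by (auto simp: arc)
    \<comment> \<open>\<open>k\<close> is the first stop on the path from \<open>i\<close> to
      \<open>j\<close>. It is equivalent to \<open>i\<close> and larger, so the minimality of
      \<open>j\<close> leaves only \<open>k = j\<close>.\<close>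
    then obtain k where k: "(i, k) \<in> A" "(k, j) \<in> A\<^sup>*"
      using up by (metis converse_rtranclE less_irrefl)
    have "(i, k) \<in> E" using k(1) sub by (auto simp: E_def)
    then have "j \<le> k" using ij(3) less k(1) by blast
    then have "k = j" using le[OF k(2)] by simp
    then show "(i, j) \<in> A" using k by simp
  next
    assume ij: "(i, j) \<in> A"
    have "j \<le> l" if il: "(i, l) \<in> E" "i < l" for l
    proof -
      \<comment> \<open>The path from \<open>i\<close> to \<open>l\<close> has to begin with the
        only arc leaving \<open>i\<close>, so \<open>k\<close> is \<open>j\<close>.\<close>
      obtain k where "(i, k) \<in> A" "(k, l) \<in> A\<^sup>*"
        using up[OF il] il(2) by (metis converse_rtranclE less_irrefl)
      then show ?thesis using le left ij by (metis single_valuedD)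
    qed
    moreover have "(i, j) \<in> E" using ij sub by (auto simp: E_def)
    ultimately show "(i, j) \<in> Arc P" using less[OF ij] by (simp add: arc)
  qed
  then have "Arc P = A" by auto
  then show thesis using P that by blast
qed

text \<open>The maximum in \<open>cr\<close> is over a nonempty finite set: the empty crossing gives
  0, and the left endpoints of a crossing are distinct points of \<open>{1..n}\<close>. The first
  two arcs of a longer monochromatic crossing already form a 2-crossing.\<close>

lemma cr_less_2_iff:
  assumes "partition_on {1..n} P"
  shows "cr (P, \<phi>) < 2 \<longleftrightarrow>
    \<not> (\<exists>i j k l. (i, k) \<in> Arc P \<and> (j, l) \<in> Arc P \<and> \<phi> (i, k) = \<phi> (j, l) \<and> i < j \<and> j < k \<and> k < l)"
proof -
  define K where "K = {k. \<exists>as. is_crossing P k as \<and> (\<exists>c. \<forall>a\<in>set as. \<phi> a = c)}"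
  have "k \<le> n" if k: "k \<in> K" for k
  proof -
    obtain as where as: "is_crossing P k as" using k by (auto simp: K_def)
    then have "sorted_wrt (<) (map fst as)"
      by (simp add: is_crossing_def sorted_wrt_append)
    then have "distinct (map fst as)" by (simp add: strict_sorted_iff)
    moreover have "set (map fst as) \<subseteq> {1..n}"
      using as Arc_subset[OF assms] by (auto simp: is_crossing_def)
    ultimately have "length (map fst as) \<le> card {1..n}"
      by (metis card_mono distinct_card finite_atLeastAtMost)
    then show ?thesis using as by (simp add: is_crossing_def)
  qed
  then have fin: "finite K" by (meson finite_nat_set_iff_bounded_le)
  have "0 \<in> K" by (auto simp: K_def is_crossing_def)
  then have "cr (P, \<phi>) < 2 \<longleftrightarrow> (\<forall>k\<in>K. k < 2)"
    using Max_less_iff[OF fin, of 2] by (auto simp: cr_def K_def[symmetric])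
  also have "\<dots> \<longleftrightarrow>
    \<not> (\<exists>i j k l. (i, k) \<in> Arc P \<and> (j, l) \<in> Arc P \<and> \<phi> (i, k) = \<phi> (j, l) \<and> i < j \<and> j < k \<and> k < l)"
    (is "_ \<longleftrightarrow> \<not> ?X")
  proof (intro iffI notI)
    assume K: "\<not> ?X"
    show "\<forall>k\<in>K. k < 2"
    proof
      fix m assume "m \<in> K"
      then obtain as c where as: "is_crossing P m as" "\<forall>a\<in>set as. \<phi> a = c" by (auto simp: K_def)
      show "m < 2"
      proof (rule ccontr)
        assume "\<not> m < 2"
        then obtain i k j l bs where "as = (i, k) # (j, l) # bs"
          using as(1) unfolding is_crossing_def
          by (cases as rule: list.exhaust; cases "tl as") auto
        then have "(i, k) \<in> Arc P" "(j, l) \<in> Arc P" "\<phi> (i, k) = \<phi> (j, l)" "i < j" "j < k" "k < l"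
          using as by (simp_all add: is_crossing_def sorted_wrt_append)
        then show False using K by blast
      qed
    qed
  next
    assume "\<forall>k\<in>K. k < 2" and ?X
    then obtain i j k l where "(i, k) \<in> Arc P" "(j, l) \<in> Arc P" "\<phi> (i, k) = \<phi> (j, l)" "i < j" "j < k" "k < l"
      by blast
    then have "is_crossing P 2 [(i, k), (j, l)] \<and> (\<forall>a\<in>set [(i, k), (j, l)]. \<phi> a = \<phi> (i, k))"
      by (auto simp: is_crossing_def)
    then have "2 \<in> K" unfolding K_def by blast
    then show False using \<open>\<forall>k\<in>K. k < 2\<close> by auto
  qed
  finally show ?thesis .
qed

section \<open>Colored arc sets\<close>

text \<open>The intermediate object between colored partitions and walks: an arc diagram with the
  color stored in each arc, so that no function with a domain depending on the partition has to be
  carried along. The two uniqueness clauses make the arcs come from a partition; the last clause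
  excludes monochromatic crossings.\<close>

definition colored_arc_sets :: "nat \<Rightarrow> nat \<Rightarrow> (nat \<times> nat \<times> nat) set set" where
  "colored_arc_sets n r = {T.
     (\<forall>i j c. (i, j, c) \<in> T \<longrightarrow> 1 \<le> i \<and> i < j \<and> j \<le> n \<and> c \<in> {1..r}) \<and>
     (\<forall>i j c j' c'. (i, j, c) \<in> T \<longrightarrow> (i, j', c') \<in> T \<longrightarrow> j = j' \<and> c = c') \<and>
     (\<forall>i j c i' c'. (i, j, c) \<in> T \<longrightarrow> (i', j, c') \<in> T \<longrightarrow> i = i' \<and> c = c') \<and>
     (\<forall>i j k l c. (i, k, c) \<in> T \<longrightarrow> (j, l, c) \<in> T \<longrightarrow> i < j \<longrightarrow> j < k \<longrightarrow> l \<le> k)}"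

lemma colored_arc_setsD:
  assumes "T \<in> colored_arc_sets n r"
  shows "(i, j, c) \<in> T \<Longrightarrow> 1 \<le> i \<and> i < j \<and> j \<le> n \<and> c \<in> {1..r}"
    and "(i, j, c) \<in> T \<Longrightarrow> (i, j', c') \<in> T \<Longrightarrow> j = j' \<and> c = c'"
    and "(i, j, c) \<in> T \<Longrightarrow> (i', j, c') \<in> T \<Longrightarrow> i = i' \<and> c = c'"
    and "(i, k, c) \<in> T \<Longrightarrow> (j, l, c) \<in> T \<Longrightarrow> i < j \<Longrightarrow> j < k \<Longrightarrow> l \<le> k"
  using assms unfolding colored_arc_sets_def mem_Collect_eq by blast+

definition colored_arcs :: "nat set set \<times> (nat \<times> nat \<Rightarrow> nat) \<Rightarrow> (nat \<times> nat \<times> nat) set" where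
  "colored_arcs \<Lambda> = {(i, j, c). (i, j) \<in> Arc (fst \<Lambda>) \<and> c = snd \<Lambda> (i, j)}"

text \<open>\<open>colored_arcs\<close> is the bijection. It is injective because a partition is
  determined by its arcs and a coloring, being extensional, by its values on them. It is surjective
  because \<open>Arc_surj\<close> rebuilds the partition.\<close>

lemma Cnum_eq_card_colored_arc_sets: "Cnum n r = card (colored_arc_sets n r)"
proof -
  let ?L = "{\<Lambda> \<in> colored_partitions n r. cr \<Lambda> < 2}"
  have inj: "inj_on colored_arcs ?L"
  proof (rule inj_onI)
    fix \<Lambda> \<Lambda>' assume L: "\<Lambda> \<in> ?L" "\<Lambda>' \<in> ?L" and eq: "colored_arcs \<Lambda> = colored_arcs \<Lambda>'"
    obtain P f Q g where [simp]: "\<Lambda> = (P, f)" "\<Lambda>' = (Q, g)" by fastforce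
    have PQ: "partition_on {1..n} P" "partition_on {1..n} Q"
      and fg: "f \<in> Arc P \<rightarrow>\<^sub>E {1..r}" "g \<in> Arc Q \<rightarrow>\<^sub>E {1..r}"
      using L by (auto simp: colored_partitions_def)
    have iff: "(i, j) \<in> Arc P \<and> c = f (i, j) \<longleftrightarrow> (i, j) \<in> Arc Q \<and> c = g (i, j)" for i j c
      using eq by (auto simp: colored_arcs_def set_eq_iff)
    have "Arc P = Arc Q" using iff by auto
    then have "P = Q" using PQ Arc_inj by blast
    moreover have "f = g"
      using iff fg \<open>P = Q\<close> by (intro PiE_ext[of f "Arc P" "\<lambda>_. {1..r}" g]) auto
    ultimately show "\<Lambda> = \<Lambda>'" by simp
  qed
  have image: "colored_arcs ` ?L = colored_arc_sets n r"
  proof (intro subset_antisym subsetI)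
    fix T assume "T \<in> colored_arcs ` ?L"
    then obtain P f where T: "T = colored_arcs (P, f)"
      and P: "partition_on {1..n} P" and f: "f \<in> Arc P \<rightarrow>\<^sub>E {1..r}" and cr: "cr (P, f) < 2"
      by (auto simp: colored_partitions_def)
    have memT: "(i, j, c) \<in> T \<longleftrightarrow> (i, j) \<in> Arc P \<and> c = f (i, j)" for i j c
      by (simp add: T colored_arcs_def)
    show "T \<in> colored_arc_sets n r"
      unfolding colored_arc_sets_def mem_Collect_eq memT
    proof (intro conjI allI impI)
      fix i j c assume a: "(i, j) \<in> Arc P \<and> c = f (i, j)"
      show "1 \<le> i" "j \<le> n" "i < j" using Arc_subset[OF P] a Arc_less by auto
      show "c \<in> {1..r}" using a f by auto
    next
      fix i j k l c
      assume "(i, k) \<in> Arc P \<and> c = f (i, k)" "(j, l) \<in> Arc P \<and> c = f (j, l)" "i < j" "j < k"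
      then show "l \<le> k" using cr unfolding cr_less_2_iff[OF P] by (metis not_le)
    qed (use Arc_left_unique[OF P] Arc_right_unique[OF P] in blast)+
  next
    fix T assume T: "T \<in> colored_arc_sets n r"
    define A where "A = {(i, j). \<exists>c. (i, j, c) \<in> T}"
    have AT: "(i, j) \<in> A \<longleftrightarrow> (\<exists>c. (i, j, c) \<in> T)" for i j by (simp add: A_def)
    obtain P where P: "partition_on {1..n} P" and arc: "Arc P = A"
    proof (rule Arc_surj)
      show "A \<subseteq> {1..n} \<times> {1..n}" using colored_arc_setsD(1)[OF T] by (fastforce simp: AT)
      show "i < j" if "(i, j) \<in> A" for i j using that colored_arc_setsD(1)[OF T] by (auto simp: AT)
      show "single_valued A" "single_valued (A\<inverse>)"
        using colored_arc_setsD(2,3)[OF T] unfolding single_valued_def by (simp_all add: AT) blast+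
    qed
    \<comment> \<open>The color of an arc is unique because only one arc opens at its left end;
      \<open>restrict\<close> makes the coloring extensional.\<close>
    define f where "f = restrict (\<lambda>(i, j). THE c. (i, j, c) \<in> T) A"
    have f: "f (i, j) = c" if "(i, j, c) \<in> T" for i j c
    proof -
      have "(THE c. (i, j, c) \<in> T) = c" using that colored_arc_setsD(2)[OF T] by blast
      then show ?thesis using that by (auto simp: f_def AT)
    qed
    have "f \<in> A \<rightarrow>\<^sub>E {1..r}"
    proof (rule PiE_I)
      fix x assume "x \<in> A"
      then obtain i j c where "x = (i, j)" "(i, j, c) \<in> T" by (auto simp: A_def)
      then show "f x \<in> {1..r}" using f colored_arc_setsD(1)[OF T] by metis
    qed (simp add: f_def)
    moreover have "cr (P, f) < 2"
      unfolding cr_less_2_iff[OF P] arc AT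
      using colored_arc_setsD(4)[OF T] f by (metis not_le)
    ultimately have "(P, f) \<in> ?L" using P arc by (simp add: colored_partitions_def)
    moreover have "T = colored_arcs (P, f)"
      using f by (auto simp: colored_arcs_def arc AT)
    ultimately show "T \<in> colored_arcs ` ?L" by blast
  qed
  show ?thesis using card_image[OF inj] unfolding image Cnum_def by simp
qed

section \<open>Opening and closing colors\<close>

text \<open>The color 0 records that no arc opens, respectively closes, at the given point.\<close>

definition open_color :: "(nat \<times> nat \<times> nat) set \<Rightarrow> nat \<Rightarrow> nat" where
  "open_color T i = (if \<exists>j c. (i, j, c) \<in> T then THE c. \<exists>j. (i, j, c) \<in> T else 0)"

definition close_color :: "(nat \<times> nat \<times> nat) set \<Rightarrow> nat \<Rightarrow> nat" where
  "close_color T j = (if \<exists>i c. (i, j, c) \<in> T then THE c. \<exists>i. (i, j, c) \<in> T else 0)"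

text \<open>At most one arc opens at \<open>i\<close>, so the definite description picks its color.
  The value 0 has to be excluded: it stands for the absence of an arc, and no arc has color
  0.\<close>

lemma open_color_eq_iff:
  assumes T: "T \<in> colored_arc_sets n r" and "c \<noteq> 0"
  shows "open_color T i = c \<longleftrightarrow> (\<exists>j. (i, j, c) \<in> T)"
proof (cases "\<exists>j c. (i, j, c) \<in> T")
  case True
  then obtain j d where d: "(i, j, d) \<in> T" by blast
  then have "(THE c. \<exists>j. (i, j, c) \<in> T) = d" using colored_arc_setsD(2)[OF T] by blast
  then have "open_color T i = d" using d by (auto simp: open_color_def)
  then show ?thesis using d colored_arc_setsD(2)[OF T] by blast
qed (use assms(2) in \<open>auto simp: open_color_def\<close>)

lemma close_color_eq_iff:
  assumes T: "T \<in> colored_arc_sets n r" and "c \<noteq> 0"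
  shows "close_color T j = c \<longleftrightarrow> (\<exists>i. (i, j, c) \<in> T)"
proof (cases "\<exists>i c. (i, j, c) \<in> T")
  case True
  then obtain i d where d: "(i, j, d) \<in> T" by blast
  then have "(THE c. \<exists>i. (i, j, c) \<in> T) = d" using colored_arc_setsD(3)[OF T] by blast
  then have "close_color T j = d" using d by (auto simp: close_color_def)
  then show ?thesis using d colored_arc_setsD(3)[OF T] by blast
qed (use assms(2) in \<open>auto simp: close_color_def\<close>)

lemma open_color_le:
  assumes "T \<in> colored_arc_sets n r"
  shows "open_color T i \<le> r"
  using open_color_eq_iff[OF assms, of "open_color T i" i] colored_arc_setsD(1)[OF assms]
  by (cases "open_color T i = 0") auto

lemma close_color_le:
  assumes "T \<in> colored_arc_sets n r"
  shows "close_color T j \<le> r"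
  using close_color_eq_iff[OF assms, of "close_color T j" j] colored_arc_setsD(1)[OF assms]
  by (cases "close_color T j = 0") auto

text \<open>This and the next lemma are why \<open>n - 1\<close> steps carry all the information: a
  walk has no entry for an opening at \<open>n\<close> or a closing at 1.\<close>

lemma open_color_outside:
  assumes "T \<in> colored_arc_sets n r" and "i = 0 \<or> n \<le> i"
  shows "open_color T i = 0"
  using colored_arc_setsD(1)[OF assms(1)] assms(2) by (fastforce simp: open_color_def)

lemma close_color_outside:
  assumes "T \<in> colored_arc_sets n r" and "j \<le> 1 \<or> n < j"
  shows "close_color T j = 0"
  using colored_arc_setsD(1)[OF assms(1)] assms(2) by (fastforce simp: close_color_def)

text \<open>Strong induction on the right end \<open>j\<close>. Suppose arcs of one color end at
  \<open>j\<close>, from \<open>i\<close> in one set and from a later \<open>i'\<close> in the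
  other. In the first set \<open>i'\<close> opens an arc of that color too, which must close before
  \<open>j\<close> to avoid a crossing. By induction it lies in the other set as well, where
  \<open>i'\<close> is already joined to \<open>j\<close>.\<close>

lemma colored_arc_set_eqI:
  assumes T: "T \<in> colored_arc_sets n r" and U: "U \<in> colored_arc_sets n r"
    and op: "open_color T = open_color U" and cl: "close_color T = close_color U"
  shows "T = U"
proof -
  have iff_op: "(\<exists>j. (i, j, c) \<in> T) \<longleftrightarrow> (\<exists>j. (i, j, c) \<in> U)" if "c \<noteq> 0" for i c
    using open_color_eq_iff[OF T that] open_color_eq_iff[OF U that] op by simp
  have iff_cl: "(\<exists>i. (i, j, c) \<in> T) \<longleftrightarrow> (\<exists>i. (i, j, c) \<in> U)" if "c \<noteq> 0" for j c
    using close_color_eq_iff[OF T that] close_color_eq_iff[OF U that] cl by simp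
  \<comment> \<open>Stated for arbitrary \<open>V\<close> and \<open>W\<close>, to be used with
    \<open>T\<close> and \<open>U\<close> in both orders.\<close>
  have not_less: "\<not> i < i'"
    if V: "V \<in> colored_arc_sets n r"
      and IH: "\<And>m i c. m < j \<Longrightarrow> (i, m, c) \<in> V \<longleftrightarrow> (i, m, c) \<in> W"
      and ex: "\<exists>k. (i', k, c) \<in> V"
      and W: "W \<in> colored_arc_sets n r"
      and arcs: "(i, j, c) \<in> V" "(i', j, c) \<in> W" for V W i i' j c
  proof
    assume "i < i'"
    obtain k where k: "(i', k, c) \<in> V" using ex by blast
    have "i' < j" using colored_arc_setsD(1)[OF W arcs(2)] by simp
    then have "k \<le> j" using colored_arc_setsD(4)[OF V arcs(1) k \<open>i < i'\<close>] by simp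
    moreover have "k \<noteq> j" using colored_arc_setsD(3)[OF V arcs(1)] k \<open>i < i'\<close> by blast
    ultimately have "(i', k, c) \<in> W" "k \<noteq> j" using IH k by auto
    then show False using colored_arc_setsD(2)[OF W arcs(2)] by blast
  qed
  have "(i, j, c) \<in> T \<longleftrightarrow> (i, j, c) \<in> U" for i j c
  proof (induction j arbitrary: i c rule: less_induct)
    case (less j)
    have eq: "i = i'" if t: "(i, j, c) \<in> T" and u: "(i', j, c) \<in> U" for i i'
    proof -
      have c: "c \<noteq> 0" using colored_arc_setsD(1)[OF T t] by auto
      have "\<not> i < i'" using not_less[OF T less.IH _ U t u] iff_op[OF c] u by blast
      moreover have "\<not> i' < i"
        using not_less[OF U less.IH[symmetric] _ T u t] iff_op[OF c] t by blast
      ultimately show ?thesis by simp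
    qed
    show ?case
    proof (cases "c = 0")
      case True
      then show ?thesis
        using colored_arc_setsD(1)[OF T, of i j c] colored_arc_setsD(1)[OF U, of i j c] by auto
    next
      case False
      \<comment> \<open>By the closing colors, an arc of color \<open>c\<close> ends at
        \<open>j\<close> in both sets or in neither; \<open>eq\<close> identifies the left
        ends.\<close>
      show ?thesis using eq iff_cl[OF False] by metis
    qed
  qed
  then show ?thesis by auto
qed

text \<open>The state of a scan from left to right after the points up to \<open>m\<close>. It is
  deliberately asymmetric: closings up to \<open>m\<close> have found their arcs, while openings may
  still be waiting for a right end.\<close>

definition partial_matching ::
  "(nat \<Rightarrow> nat) \<Rightarrow> (nat \<Rightarrow> nat) \<Rightarrow> nat \<Rightarrow> (nat \<times> nat \<times> nat) set \<Rightarrow> bool" where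
  "partial_matching op cl m T \<longleftrightarrow>
     (\<forall>i j c. (i, j, c) \<in> T \<longrightarrow> 1 \<le> i \<and> i < j \<and> j \<le> m \<and> c \<noteq> 0 \<and> op i = c \<and> cl j = c) \<and>
     (\<forall>i j c j' c'. (i, j, c) \<in> T \<longrightarrow> (i, j', c') \<in> T \<longrightarrow> j = j') \<and>
     (\<forall>i j c i' c'. (i, j, c) \<in> T \<longrightarrow> (i', j, c') \<in> T \<longrightarrow> i = i') \<and>
     (\<forall>i j k l c. (i, k, c) \<in> T \<longrightarrow> (j, l, c) \<in> T \<longrightarrow> i < j \<longrightarrow> j < k \<longrightarrow> l \<le> k) \<and>
     (\<forall>j c. 1 \<le> j \<longrightarrow> j \<le> m \<longrightarrow> cl j = c \<longrightarrow> c \<noteq> 0 \<longrightarrow> (\<exists>i. (i, j, c) \<in> T)) \<and>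
     (\<forall>i j k c. (i, k, c) \<in> T \<longrightarrow> i < j \<longrightarrow> j < k \<longrightarrow> op j = c \<longrightarrow> (\<exists>l. (j, l, c) \<in> T))"

lemma partial_matchingD:
  assumes "partial_matching op cl m T"
  shows "(i, j, c) \<in> T \<Longrightarrow> 1 \<le> i \<and> i < j \<and> j \<le> m \<and> c \<noteq> 0 \<and> op i = c \<and> cl j = c"
    and "(i, j, c) \<in> T \<Longrightarrow> (i, j', c') \<in> T \<Longrightarrow> j = j'"
    and "(i, j, c) \<in> T \<Longrightarrow> (i', j, c') \<in> T \<Longrightarrow> i = i'"
    and "(i, k, c) \<in> T \<Longrightarrow> (j, l, c) \<in> T \<Longrightarrow> i < j \<Longrightarrow> j < k \<Longrightarrow> l \<le> k"
    and "1 \<le> j \<Longrightarrow> j \<le> m \<Longrightarrow> cl j = c \<Longrightarrow> c \<noteq> 0 \<Longrightarrow> \<exists>i. (i, j, c) \<in> T"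
    and "(i, k, c) \<in> T \<Longrightarrow> i < j \<Longrightarrow> j < k \<Longrightarrow> op j = c \<Longrightarrow> \<exists>l. (j, l, c) \<in> T"
  using assms unfolding partial_matching_def by (blast | metis)+

text \<open>Every closing point is matched with the last unmatched opening point of its color; the
  final clause of the invariant, that all points of this color opening under an arc are already
  matched, is what rules out crossings later on.\<close>

lemma partial_matching_exists:
  assumes bal: "\<And>t c. t < n \<Longrightarrow> c \<noteq> 0 \<Longrightarrow>
      card {j \<in> {1..Suc t}. cl j = c} \<le> card {i \<in> {1..t}. op i = c}"
    and "m \<le> n"
  shows "\<exists>T. partial_matching op cl m T"
  using assms(2)
proof (induction m)
  case 0
  have "partial_matching op cl 0 {}" by (simp add: partial_matching_def)
  then show ?case by blast
next
  case (Suc m)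
  then obtain T where T: "partial_matching op cl m T" by auto
  note D = partial_matchingD[OF T]
  show ?case
  proof (cases "cl (Suc m) = 0")
    case True
    have "partial_matching op cl (Suc m) T"
      unfolding partial_matching_def
    proof (intro conjI allI impI)
      fix j c assume "1 \<le> j" "j \<le> Suc m" "cl j = c" "c \<noteq> 0"
      then show "\<exists>i. (i, j, c) \<in> T" using D(5)[of j c] True by (cases "j = Suc m") auto
    next
      fix i j c assume "(i, j, c) \<in> T"
      from D(1)[OF this]
      show "1 \<le> i" "i < j" "j \<le> Suc m" "c \<noteq> 0" "op i = c" "cl j = c" by simp_all
    next
      fix i j c j' c' assume "(i, j, c) \<in> T" "(i, j', c') \<in> T"
      then show "j = j'" by (rule D(2))
    next
      fix i j c i' c' assume "(i, j, c) \<in> T" "(i', j, c') \<in> T"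
      then show "i = i'" by (rule D(3))
    next
      fix i j k l c assume "(i, k, c) \<in> T" "(j, l, c) \<in> T" "i < j" "j < k"
      then show "l \<le> k" by (rule D(4))
    next
      fix i j k c assume "(i, k, c) \<in> T" "i < j" "j < k" "op j = c"
      then show "\<exists>l. (j, l, c) \<in> T" by (rule D(6))
    qed
    then show ?thesis by blast
  next
    case False
    define c where "c = cl (Suc m)"
    define F where "F = {i \<in> {1..m}. op i = c \<and> (\<nexists>j. (i, j, c) \<in> T)}"
    \<comment> \<open>If every opening of color \<open>c\<close> up to \<open>m\<close> were
      matched, there would be no more of them than closings up to \<open>m\<close>. The closing at
      \<open>Suc m\<close> would then violate the balance condition.\<close>
    have "F \<noteq> {}"
    proof
      assume "F = {}"
      have "card {i \<in> {1..m}. op i = c} \<le> card {j \<in> {1..m}. cl j = c}"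
      proof (rule card_le_if_related[where R = "\<lambda>i j. (i, j, c) \<in> T"])
        fix i assume i: "i \<in> {i \<in> {1..m}. op i = c}"
        then obtain j where "(i, j, c) \<in> T" using \<open>F = {}\<close> by (auto simp: F_def)
        then show "\<exists>j\<in>{j \<in> {1..m}. cl j = c}. (i, j, c) \<in> T"
          using D(1)[of i j c] by (intro bexI[of _ j]) auto
      qed (use D(3) in auto)
      moreover have "{j \<in> {1..Suc m}. cl j = c} = insert (Suc m) {j \<in> {1..m}. cl j = c}"
        by (auto simp: c_def le_Suc_eq)
      then have "card {j \<in> {1..Suc m}. cl j = c} = Suc (card {j \<in> {1..m}. cl j = c})"
        by simp
      ultimately show False using bal[of m c] Suc.prems False by (simp add: c_def)
    qed
    define p where "p = Max F"
    have "finite F" by (simp add: F_def)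
    then have "p \<in> F" and pmax: "\<And>i. i \<in> F \<Longrightarrow> i \<le> p"
      using \<open>F \<noteq> {}\<close> by (simp_all add: p_def)
    \<comment> \<open>An arc of \<open>T\<close> starting at \<open>p\<close> would have color
      \<open>op p = c\<close>, so \<open>p\<close> starts no arc of any color.\<close>
    then have p: "1 \<le> p" "p \<le> m" "op p = c" and free: "(p, j, d) \<notin> T" for j d
      using D(1)[of p j d] by (auto simp: F_def)
    \<comment> \<open>Maximality of \<open>p\<close> gives the final clause of the invariant for the
      new arc.\<close>
    have last: "\<exists>l. (j, l, c) \<in> T" if "p < j" "j < Suc m" "op j = c" for j
      using pmax[of j] that by (auto simp: F_def)
    have noright: "(i, Suc m, d) \<notin> T" for i d using D(1)[of i "Suc m" d] by auto
    have c: "c \<noteq> 0" "cl (Suc m) = c" using False by (simp_all add: c_def)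
    have "partial_matching op cl (Suc m) (insert (p, Suc m, c) T)"
      unfolding partial_matching_def
    proof (intro conjI allI impI)
      fix i j k l d
      assume a: "(i, k, d) \<in> insert (p, Suc m, c) T" "(j, l, d) \<in> insert (p, Suc m, c) T" "i < j" "j < k"
      show "l \<le> k"
      proof (cases "(i, k, d) \<in> T")
        case True
        \<comment> \<open>The arc opening under an old arc cannot be the new one: by the final
          clause \<open>p\<close> would have been matched already.\<close>
        then have "(j, l, d) \<in> T"
          using a D(6)[OF True \<open>i < j\<close> \<open>j < k\<close>] p free by auto
        then show ?thesis using D(4)[OF True] a by blast
      next
        case False
        then show ?thesis using a D(1)[of j l d] by auto
      qed
    next
      fix j d assume a: "1 \<le> j" "j \<le> Suc m" "cl j = d" "d \<noteq> 0"
      show "\<exists>i. (i, j, d) \<in> insert (p, Suc m, c) T"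
      proof (cases "j = Suc m")
        case True
        then show ?thesis using a c by auto
      next
        case False
        then show ?thesis using a D(5)[of j d] by auto
      qed
    next
      fix i j k d
      assume a: "(i, k, d) \<in> insert (p, Suc m, c) T" "i < j" "j < k" "op j = d"
      then show "\<exists>l. (j, l, d) \<in> insert (p, Suc m, c) T"
        using D(6)[of i k d j] last[of j] by auto
    next
      fix i j d assume "(i, j, d) \<in> insert (p, Suc m, c) T"
      then consider "i = p" "j = Suc m" "d = c" | "(i, j, d) \<in> T" by auto
      then show "1 \<le> i" "i < j" "j \<le> Suc m" "d \<noteq> 0" "op i = d" "cl j = d"
        using D(1)[of i j d] p c by (cases; simp)+
    next
      fix i j d j' d'
      assume "(i, j, d) \<in> insert (p, Suc m, c) T" "(i, j', d') \<in> insert (p, Suc m, c) T"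
      then show "j = j'" using D(2)[of i j d j' d'] free by auto
    next
      fix i j d i' d'
      assume "(i, j, d) \<in> insert (p, Suc m, c) T" "(i', j, d') \<in> insert (p, Suc m, c) T"
      then show "i = i'" using D(3)[of i j d i' d'] noright by auto
    qed
    then show ?thesis by blast
  qed
qed

text \<open>At \<open>m = n\<close> all closings are matched, each with its own opening. Since the
  totals agree for every color, the matched openings \<open>?M\<close> are all the openings, so none
  is left waiting.\<close>

lemma colored_arc_set_exists:
  assumes op: "\<And>i. op i \<le> r" "\<And>i. i = 0 \<or> n \<le> i \<Longrightarrow> op i = 0"
    and cl: "\<And>j. cl j \<le> r" "\<And>j. j \<le> 1 \<or> n < j \<Longrightarrow> cl j = 0"
    and bal: "\<And>t c. t < n \<Longrightarrow> c \<noteq> 0 \<Longrightarrow>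
      card {j \<in> {1..Suc t}. cl j = c} \<le> card {i \<in> {1..t}. op i = c}"
    and total: "\<And>c. c \<noteq> 0 \<Longrightarrow> card {j \<in> {1..n}. cl j = c} = card {i \<in> {1..n}. op i = c}"
  obtains T where "T \<in> colored_arc_sets n r" and "open_color T = op" and "close_color T = cl"
proof -
  obtain T where pm: "partial_matching op cl n T"
    using partial_matching_exists[OF bal] by blast
  note D = partial_matchingD[OF pm]
  have "\<exists>j. (i, j, c) \<in> T" if i: "op i = c" "c \<noteq> 0" for i c
  proof -
    have in_range: "i \<in> {1..n}"
      using op(2)[of i] i by (cases "i = 0 \<or> n \<le> i") auto
    let ?M = "{i \<in> {1..n}. \<exists>j. (i, j, c) \<in> T}"
    have "card {j \<in> {1..n}. cl j = c} \<le> card ?M"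
    proof (rule card_le_if_related[where R = "\<lambda>j i. (i, j, c) \<in> T"])
      fix j assume "j \<in> {j \<in> {1..n}. cl j = c}"
      then obtain i where "(i, j, c) \<in> T" using D(5)[of j c] i by auto
      then show "\<exists>i\<in>?M. (i, j, c) \<in> T" using D(1)[of i j c] by (intro bexI[of _ i]) auto
    qed (use D(2) in auto)
    moreover have "?M \<subseteq> {i \<in> {1..n}. op i = c}" using D(1) by blast
    ultimately have "?M = {i \<in> {1..n}. op i = c}"
      using total[OF i(2)] by (intro card_seteq) auto
    then show ?thesis using in_range i by blast
  qed
  then have opT: "op i = c \<longleftrightarrow> (\<exists>j. (i, j, c) \<in> T)" if "c \<noteq> 0" for i c
    using that D(1) by blast
  have clT: "cl j = c \<longleftrightarrow> (\<exists>i. (i, j, c) \<in> T)" if "c \<noteq> 0" for j c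
    using that D(1)[of _ j c] D(5)[of j c] cl(2)[of j]
    by (metis nat_le_linear not_less)
  have T: "T \<in> colored_arc_sets n r"
    unfolding colored_arc_sets_def mem_Collect_eq
  proof (intro conjI allI impI)
    fix i j c assume "(i, j, c) \<in> T"
    from D(1)[OF this] op(1)[of i] show "1 \<le> i" "i < j" "j \<le> n" "c \<in> {1..r}" by auto
  qed (use D in \<open>blast | metis\<close>)+
  moreover have "open_color T = op"
  proof
    fix i show "open_color T i = op i"
      using open_color_eq_iff[OF T] opT by (metis (no_types))
  qed
  moreover have "close_color T = cl"
  proof
    fix j show "close_color T j = cl j"
      using close_color_eq_iff[OF T] clT by (metis (no_types))
  qed
  ultimately show thesis by (rule that)
qed

section \<open>Walks\<close>

text \<open>A step is a pair of colors in \<open>{0..r}\<close>: the \<open>t\<close>-th step records the color opening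
  at \<open>t\<close> and the color closing at \<open>t + 1\<close>. The zero steps are the pairs \<open>(c, c)\<close>, where
  \<open>(0, 0)\<close> is labelled \<open>Stay (r + 1)\<close>.\<close>

fun step_open :: "nat \<Rightarrow> step \<Rightarrow> nat" where
  "step_open r (Up i) = i"
| "step_open r (Down i) = 0"
| "step_open r (Exchange i j) = i"
| "step_open r (Stay c) = (if c = r + 1 then 0 else c)"

fun step_close :: "nat \<Rightarrow> step \<Rightarrow> nat" where
  "step_close r (Up i) = 0"
| "step_close r (Down i) = i"
| "step_close r (Exchange i j) = j"
| "step_close r (Stay c) = (if c = r + 1 then 0 else c)"

text \<open>Inverse to the pair \<open>step_open\<close>, \<open>step_close\<close>: it identifies
  \<open>steps r\<close> with the pairs of colors in \<open>{0..r}\<close>.\<close>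

definition make_step :: "nat \<Rightarrow> nat \<Rightarrow> nat \<Rightarrow> step" where
  "make_step r a b =
     (if a = b then Stay (if a = 0 then r + 1 else a)
      else if b = 0 then Up a else if a = 0 then Down b else Exchange a b)"

lemma make_step_in_steps: "a \<le> r \<Longrightarrow> b \<le> r \<Longrightarrow> make_step r a b \<in> steps r"
  by (auto simp: make_step_def steps_def)

lemma step_open_make_step: "a \<le> r \<Longrightarrow> step_open r (make_step r a b) = a"
  by (auto simp: make_step_def)

lemma step_close_make_step: "b \<le> r \<Longrightarrow> step_close r (make_step r a b) = b"
  by (auto simp: make_step_def)

lemma make_step_open_close: "s \<in> steps r \<Longrightarrow> make_step r (step_open r s) (step_close r s) = s"
  by (auto simp: make_step_def steps_def split: if_splits)

lemma step_open_le: "s \<in> steps r \<Longrightarrow> step_open r s \<le> r"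
  and step_close_le: "s \<in> steps r \<Longrightarrow> step_close r s \<le> r"
  by (auto simp: steps_def)

text \<open>An opening of color \<open>k\<close> raises coordinate \<open>k\<close> and a closing
  lowers it; in a zero step the two contributions cancel. Coordinate 0 is treated apart, since the
  value 0 marks a missing color.\<close>

lemma displacement_eq:
  assumes "s \<in> steps r" and "k \<noteq> 0"
  shows "displacement s k = of_bool (step_open r s = k) - of_bool (step_close r s = k)"
  using assms by (auto simp: steps_def unit_vec_def)

lemma displacement_0: "s \<in> steps r \<Longrightarrow> displacement s 0 = 0"
  by (auto simp: steps_def unit_vec_def)

text \<open>Step number \<open>t\<close> stands at list index \<open>t - 1\<close> and governs the
  opening at point \<open>t\<close> and the closing at point \<open>t + 1\<close>. Hence the shift
  by 1 here and by 2 in \<open>walk_close\<close>.\<close>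

definition walk_open :: "nat \<Rightarrow> step list \<Rightarrow> nat \<Rightarrow> nat" where
  "walk_open r w i = (if 1 \<le> i \<and> i \<le> length w then step_open r (w ! (i - 1)) else 0)"

definition walk_close :: "nat \<Rightarrow> step list \<Rightarrow> nat \<Rightarrow> nat" where
  "walk_close r w j = (if 2 \<le> j \<and> j \<le> Suc (length w) then step_close r (w ! (j - 2)) else 0)"

lemma position_Suc:
  "t < length w \<Longrightarrow> position w (Suc t) k = position w t k + displacement (w ! t) k"
  by (simp add: position_def take_Suc_conv_app_nth)

lemma card_Collect_Suc:
  "card {i \<in> {1..Suc t}. f i = (k::nat)} = card {i \<in> {1..t}. f i = k} + of_bool (f (Suc t) = k)"
proof -
  have "{i \<in> {1..Suc t}. f i = k} =
      (if f (Suc t) = k then insert (Suc t) {i \<in> {1..t}. f i = k} else {i \<in> {1..t}. f i = k})"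
    by (auto simp: le_Suc_eq)
  then show ?thesis by simp
qed

text \<open>For a walk coming from an arc set, this difference counts the arcs of color
  \<open>k\<close> that pass strictly over the point \<open>Suc t\<close>.\<close>

lemma position_eq:
  assumes "set w \<subseteq> steps r" and "k \<noteq> 0" and "t \<le> length w"
  shows "position w t k = int (card {i \<in> {1..t}. walk_open r w i = k})
    - int (card {j \<in> {1..Suc t}. walk_close r w j = k})"
  using assms(3)
proof (induction t)
  case 0
  \<comment> \<open>Before the first step the closings already range over point 1, where
    \<open>walk_close\<close> has its default 0.\<close>
  have "{j \<in> {1..Suc 0}. walk_close r w j = k} = {}"
    using assms(2) by (auto simp: walk_close_def)
  then show ?case by (simp add: position_def)
next
  case (Suc t)
  have "displacement (w ! t) k
      = of_bool (walk_open r w (Suc t) = k) - of_bool (walk_close r w (Suc (Suc t)) = k)"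
    using displacement_eq[of "w ! t" r k] assms Suc.prems
    by (simp add: walk_open_def walk_close_def subset_iff)
  then show ?case
    using Suc card_Collect_Suc[of t "walk_open r w" k] card_Collect_Suc[of "Suc t" "walk_close r w" k]
    by (simp add: position_Suc)
qed

lemma position_0:
  assumes "set w \<subseteq> steps r" and "t \<le> length w"
  shows "position w t 0 = 0"
  using assms(2)
proof (induction t)
  case (Suc t)
  then show ?case using displacement_0[of "w ! t" r] assms(1) by (simp add: position_Suc subset_iff)
qed (simp add: position_def)

lemma walk_open_le: "set w \<subseteq> steps r \<Longrightarrow> walk_open r w i \<le> r"
  by (auto simp: walk_open_def intro!: step_open_le)

lemma walk_close_le: "set w \<subseteq> steps r \<Longrightarrow> walk_close r w j \<le> r"
  by (auto simp: walk_close_def intro!: step_close_le)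

text \<open>Translates the walk conditions into the hypotheses of
  \<open>colored_arc_set_exists\<close>: staying in the orthant is the balance condition, returning
  to the origin is the equality of totals.\<close>

lemma closed_walks_iff:
  assumes w: "set w \<subseteq> steps r" and m: "length w = m"
  shows "w \<in> closed_walks r m \<longleftrightarrow>
    (\<forall>t\<le>m. \<forall>k. k \<noteq> 0 \<longrightarrow>
      card {j \<in> {1..Suc t}. walk_close r w j = k} \<le> card {i \<in> {1..t}. walk_open r w i = k}) \<and>
    (\<forall>k. k \<noteq> 0 \<longrightarrow>
      card {j \<in> {1..Suc m}. walk_close r w j = k} = card {i \<in> {1..m}. walk_open r w i = k})"
    (is "_ \<longleftrightarrow> ?bal \<and> ?total")
proof -
  have pos: "position w t k = int (card {i \<in> {1..t}. walk_open r w i = k})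
      - int (card {j \<in> {1..Suc t}. walk_close r w j = k})" if "t \<le> m" "k \<noteq> 0" for t k
    using position_eq[OF w] that m by simp
  have pos0: "position w t 0 = 0" if "t \<le> m" for t using position_0[OF w] that m by simp
  \<comment> \<open>Coordinates outside \<open>{1..r}\<close> vanish by themselves: 0 receives no
    displacement, and no color exceeds \<open>r\<close>.\<close>
  have out: "position w t k = 0" if "t \<le> m" "k \<notin> {1..r}" for t k
  proof (cases "k = 0")
    case False
    then have "k > r" using that by auto
    then have "{i \<in> {1..t}. walk_open r w i = k} = {}" "{j \<in> {1..Suc t}. walk_close r w j = k} = {}"
      using walk_open_le[OF w] walk_close_le[OF w] leD by blast+
    then show ?thesis using pos[OF that(1) False] by (simp only: card.empty)
  qed (simp add: pos0 that)
  have nonneg: "0 \<le> position w t k \<longleftrightarrow>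
      card {j \<in> {1..Suc t}. walk_close r w j = k} \<le> card {i \<in> {1..t}. walk_open r w i = k}"
    if "t \<le> m" "k \<noteq> 0" for t k
    unfolding pos[OF that] by linarith
  have zero: "position w m k = 0 \<longleftrightarrow>
      card {j \<in> {1..Suc m}. walk_close r w j = k} = card {i \<in> {1..m}. walk_open r w i = k}"
    if "k \<noteq> 0" for k
    unfolding pos[OF order.refl that] by linarith
  have "(\<forall>t\<le>m. position w t \<in> orthant r) \<longleftrightarrow> (\<forall>t\<le>m. \<forall>k. k \<noteq> 0 \<longrightarrow> 0 \<le> position w t k)"
    unfolding orthant_def mem_Collect_eq using out
    by (metis atLeastAtMost_iff not_one_le_zero order.refl)
  also have "\<dots> \<longleftrightarrow> ?bal" using nonneg by simp
  finally have "(\<forall>t\<le>m. position w t \<in> orthant r) \<longleftrightarrow> ?bal" .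
  moreover have "position w m = 0 \<longleftrightarrow> (\<forall>k. k \<noteq> 0 \<longrightarrow> position w m k = 0)"
    unfolding fun_eq_iff zero_fun_def using pos0[of m] by (metis order.refl)
  then have "position w m = 0 \<longleftrightarrow> ?total" using zero by simp
  ultimately show ?thesis using w m by (simp add: closed_walks_def)
qed

lemma walk_eqI:
  assumes "set v \<subseteq> steps r" "set w \<subseteq> steps r" "length v = length w"
    and op: "walk_open r v = walk_open r w" and cl: "walk_close r v = walk_close r w"
  shows "v = w"
proof (rule nth_equalityI)
  fix t assume t: "t < length v"
  have "step_open r (v ! t) = step_open r (w ! t)"
    using fun_cong[OF op, of "Suc t"] t assms(3) by (simp add: walk_open_def)
  moreover have "step_close r (v ! t) = step_close r (w ! t)"
    using fun_cong[OF cl, of "Suc (Suc t)"] t assms(3) by (simp add: walk_close_def)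
  moreover have "v ! t \<in> steps r" "w ! t \<in> steps r" using assms t by auto
  ultimately show "v ! t = w ! t" using make_step_open_close by metis
qed (rule assms(3))

section \<open>The bijection between colored arc sets and closed walks\<close>

definition arcs_walk :: "nat \<Rightarrow> nat \<Rightarrow> (nat \<times> nat \<times> nat) set \<Rightarrow> step list" where
  "arcs_walk n r T = map (\<lambda>t. make_step r (open_color T (Suc t)) (close_color T (Suc (Suc t)))) [0..<n - 1]"

lemma
  assumes T: "T \<in> colored_arc_sets n r"
  shows length_arcs_walk: "length (arcs_walk n r T) = n - 1"
    and set_arcs_walk: "set (arcs_walk n r T) \<subseteq> steps r"
    and walk_open_arcs_walk: "walk_open r (arcs_walk n r T) = open_color T"
    and walk_close_arcs_walk: "walk_close r (arcs_walk n r T) = close_color T"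
proof -
  show "length (arcs_walk n r T) = n - 1" by (simp add: arcs_walk_def)
  show "set (arcs_walk n r T) \<subseteq> steps r"
    by (auto simp: arcs_walk_def intro!: make_step_in_steps open_color_le[OF T] close_color_le[OF T])
  show "walk_open r (arcs_walk n r T) = open_color T"
  proof
    fix i show "walk_open r (arcs_walk n r T) i = open_color T i"
      using open_color_outside[OF T, of i]
      by (auto simp: walk_open_def arcs_walk_def step_open_make_step open_color_le[OF T])
  qed
  show "walk_close r (arcs_walk n r T) = close_color T"
  proof
    fix j
    have "Suc (Suc (j - 2)) = j" if "2 \<le> j" using that by simp
    then show "walk_close r (arcs_walk n r T) j = close_color T j"
      using close_color_outside[OF T, of j]
      by (auto simp: walk_close_def arcs_walk_def step_close_make_step close_color_le[OF T])
  qed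
qed

text \<open>An arc that closes by \<open>Suc t\<close> has opened by \<open>t\<close>. This keeps
  the walk in the orthant.\<close>

lemma card_close_color_le:
  assumes T: "T \<in> colored_arc_sets n r" and c: "c \<noteq> 0"
  shows "card {j \<in> {1..Suc t}. close_color T j = c} \<le> card {i \<in> {1..t}. open_color T i = c}"
proof (rule card_le_if_related[where R = "\<lambda>j i. (i, j, c) \<in> T"])
  fix j assume j: "j \<in> {j \<in> {1..Suc t}. close_color T j = c}"
  then obtain i where i: "(i, j, c) \<in> T" by (auto simp: close_color_eq_iff[OF T c])
  have "i \<in> {i \<in> {1..t}. open_color T i = c}"
    using i j colored_arc_setsD(1)[OF T i] by (auto simp: open_color_eq_iff[OF T c])
  then show "\<exists>i\<in>{i \<in> {1..t}. open_color T i = c}. (i, j, c) \<in> T" using i by blast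
qed (use colored_arc_setsD(2)[OF T] in auto)

text \<open>Every arc closes by \<open>n\<close>. Together with the previous bound at
  \<open>t = n - 1\<close>, this brings the walk back to the origin.\<close>

lemma card_open_color_le:
  assumes T: "T \<in> colored_arc_sets n r" and c: "c \<noteq> 0"
  shows "card {i \<in> {1..t}. open_color T i = c} \<le> card {j \<in> {1..n}. close_color T j = c}"
proof (rule card_le_if_related[where R = "\<lambda>i j. (i, j, c) \<in> T"])
  fix i assume i: "i \<in> {i \<in> {1..t}. open_color T i = c}"
  then obtain j where j: "(i, j, c) \<in> T" by (auto simp: open_color_eq_iff[OF T c])
  have "j \<in> {j \<in> {1..n}. close_color T j = c}"
    using j colored_arc_setsD(1)[OF T j] by (auto simp: close_color_eq_iff[OF T c])
  then show "\<exists>j\<in>{j \<in> {1..n}. close_color T j = c}. (i, j, c) \<in> T" using j by blast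
qed (use colored_arc_setsD(3)[OF T] in auto)

lemma bij_betw_arcs_walk:
  assumes n: "n \<ge> 1"
  shows "bij_betw (arcs_walk n r) (colored_arc_sets n r) (closed_walks r (n - 1))"
proof (rule bij_betw_imageI)
  show "inj_on (arcs_walk n r) (colored_arc_sets n r)"
  proof (rule inj_onI)
    fix T U assume TU: "T \<in> colored_arc_sets n r" "U \<in> colored_arc_sets n r"
      and eq: "arcs_walk n r T = arcs_walk n r U"
    have "open_color T = open_color U" "close_color T = close_color U"
      using eq walk_open_arcs_walk[OF TU(1)] walk_open_arcs_walk[OF TU(2)]
        walk_close_arcs_walk[OF TU(1)] walk_close_arcs_walk[OF TU(2)] by metis+
    then show "T = U" by (rule colored_arc_set_eqI[OF TU])
  qed
  show "arcs_walk n r ` colored_arc_sets n r = closed_walks r (n - 1)"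
  proof (intro subset_antisym subsetI)
    fix w assume "w \<in> arcs_walk n r ` colored_arc_sets n r"
    then obtain T where T: "T \<in> colored_arc_sets n r" and w: "w = arcs_walk n r T" by blast
    show "w \<in> closed_walks r (n - 1)"
      unfolding w closed_walks_iff[OF set_arcs_walk[OF T] length_arcs_walk[OF T]]
        walk_open_arcs_walk[OF T] walk_close_arcs_walk[OF T]
    proof (intro conjI allI impI)
      fix k :: nat assume k: "k \<noteq> 0"
      have "Suc (n - 1) = n" using n by simp
      then show "card {j \<in> {1..Suc (n - 1)}. close_color T j = k} = card {i \<in> {1..n - 1}. open_color T i = k}"
        using card_close_color_le[OF T k, of "n - 1"] card_open_color_le[OF T k, of "n - 1"]
        by (metis le_antisym)
    qed (rule card_close_color_le[OF T])
  next
    fix w assume cw: "w \<in> closed_walks r (n - 1)"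
    then have w: "set w \<subseteq> steps r" "length w = n - 1" by (auto simp: closed_walks_def)
    have Suc_n: "Suc (n - 1) = n" using n by simp
    note bal = cw[unfolded closed_walks_iff[OF w] Suc_n]
    obtain T where T: "T \<in> colored_arc_sets n r"
      and op: "open_color T = walk_open r w" and cl: "close_color T = walk_close r w"
    proof (rule colored_arc_set_exists)
      show "walk_open r w i = 0" if "i = 0 \<or> n \<le> i" for i
        using that w(2) n by (auto simp: walk_open_def)
      show "walk_close r w j = 0" if "j \<le> 1 \<or> n < j" for j
        using that w(2) n by (auto simp: walk_close_def)
      show "card {j \<in> {1..n}. walk_close r w j = c} = card {i \<in> {1..n}. walk_open r w i = c}"
        if "c \<noteq> 0" for c
      proof -
        \<comment> \<open>Point \<open>n\<close> contributes nothing: a walk of \<open>n - 1\<close>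
          steps has no opening there.\<close>
        have "card {i \<in> {1..Suc (n - 1)}. walk_open r w i = c} = card {i \<in> {1..n - 1}. walk_open r w i = c}"
          unfolding card_Collect_Suc using that w(2) by (simp add: walk_open_def)
        then show ?thesis unfolding Suc_n using bal that by metis
      qed
      show "card {j \<in> {1..Suc t}. walk_close r w j = c} \<le> card {i \<in> {1..t}. walk_open r w i = c}"
        if "t < n" "c \<noteq> 0" for t c
      proof -
        have "t \<le> n - 1" using that(1) by simp
        then show ?thesis using bal that(2) by blast
      qed
    qed (use walk_open_le[OF w(1)] walk_close_le[OF w(1)] in auto)
    have "arcs_walk n r T = w"
      using walk_eqI[OF set_arcs_walk[OF T] w(1)] length_arcs_walk[OF T] w(2)
        walk_open_arcs_walk[OF T] walk_close_arcs_walk[OF T] op cl by simp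
    then show "w \<in> arcs_walk n r ` colored_arc_sets n r" using T by blast
  qed
qed

theorem theorem1p6:
  fixes n r :: nat
  assumes "n \<ge> 1" and "r \<ge> 1"
  shows "Cnum n r = card (closed_walks r (n - 1))"
  using Cnum_eq_card_colored_arc_sets bij_betw_same_card[OF bij_betw_arcs_walk[OF assms(1)]]
  by simp

end
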